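(* Let $r>3$ be an integer and suppose that there exists a finite projective plane of order $r$. Then there exists an $(r,r+1;6)$-babi-graph of order $2(r^2+r-2)$.
   Context: Graphs are finite and simple. The girth of a graph is the length of its shortest cycle; the order of a graph is its number of vertices. For integers $1\leq r\leq s$ and $g\geq 3$, an $(r,s;g)$-balanced biregular graph (for short, $(r,s;g)$-babi-graph) is a graph of girth $g$ whose set of vertex degrees equals $\{r,s\}$ and in which the number of vertices of degree $r$ equals the number of vertices of degree $s$. A finite projective plane of order $q$ is an incidence structure with $q^2+q+1$ points and $q^2+q+1$ lines such that any two distinct points are incident with precisely one common line, any two distinct lines are incident with precisely one common point, each line is incident with exactly $q+1$ points, and each point is incident with exactly $q+1$ lines. *)

theory Defs
  imports Main "HOL-Library.Extended_Nat"
begin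

definition simple_graph :: "'a set \<Rightarrow> 'a set set \<Rightarrow> bool" where
  "simple_graph V E \<longleftrightarrow> finite V \<and> (\<forall>e\<in>E. e \<subseteq> V \<and> card e = 2)"

definition degree :: "'a set set \<Rightarrow> 'a \<Rightarrow> nat" where
  "degree E v = card {e \<in> E. v \<in> e}"

(* A cycle is given by the list of its vertices, without repeating the first one
   at the end, so the length of the list is the length of the cycle. *)
definition is_cycle :: "'a set set \<Rightarrow> 'a list \<Rightarrow> bool" where
  "is_cycle E c \<longleftrightarrow>
     length c \<ge> 3 \<and> distinct c \<and>
     (\<forall>i < length c. {c ! i, c ! (Suc i mod length c)} \<in> E)"

(* The infimum of the empty set is infinity, so acyclic graphs have infinite girth. *)
definition girth :: "'a set set \<Rightarrow> enat" where
  "girth E = (INF c \<in> {c. is_cycle E c}. enat (length c))"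

definition babi_graph :: "nat \<Rightarrow> nat \<Rightarrow> nat \<Rightarrow> 'a set \<Rightarrow> 'a set set \<Rightarrow> bool" where
  "babi_graph r s g V E \<longleftrightarrow>
     simple_graph V E \<and>
     girth E = enat g \<and>
     degree E ` V = {r, s} \<and>
     card {v \<in> V. degree E v = r} = card {v \<in> V. degree E v = s}"

definition projective_plane ::
    "nat \<Rightarrow> 'p set \<Rightarrow> 'l set \<Rightarrow> ('p \<Rightarrow> 'l \<Rightarrow> bool) \<Rightarrow> bool" where
  "projective_plane q P L I \<longleftrightarrow>
     finite P \<and> card P = q\<^sup>2 + q + 1 \<and>
     finite L \<and> card L = q\<^sup>2 + q + 1 \<and>
     (\<forall>x\<in>P. \<forall>y\<in>P. x \<noteq> y \<longrightarrow> (\<exists>!l. l \<in> L \<and> I x l \<and> I y l)) \<and>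
     (\<forall>l\<in>L. \<forall>m\<in>L. l \<noteq> m \<longrightarrow> (\<exists>!x. x \<in> P \<and> I x l \<and> I x m)) \<and>
     (\<forall>l\<in>L. card {x \<in> P. I x l} = q + 1) \<and>
     (\<forall>x\<in>P. card {l \<in> L. I x l} = q + 1)"

end

theory Submission
  imports Defs
begin

text \<open>
  The incidence graph of a projective plane of order \<open>r\<close> is \<open>(r + 1)\<close>-regular of girth 6.
  Choosing a triangle in the plane and deleting its three vertices and its three sides leaves
  \<open>r\<^sup>2 + r - 2 = (r - 1) (r + 2)\<close> points and as many lines. Each remaining point lies on at most
  one side, because two sides meet only in a vertex; so the \<open>3 (r - 1)\<close> points on a side drop to
  degree \<open>r\<close> and the others keep degree \<open>r + 1\<close>. By duality the same holds for the lines.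
  So \<open>6 (r - 1)\<close> elements have degree \<open>r\<close>, whereas half of all elements, \<open>(r - 1) (r + 2)\<close>,
  should. The difference \<open>(r - 1) (r - 4)\<close> is even, and it is made up by deleting a matching of
  \<open>(r - 1) (r - 4) / 2\<close> edges between points on no side and lines through no vertex: every matched
  element loses exactly one edge.

  Such a matching exists because the \<open>(r - 1)\<^sup>2\<close> points on no side and the \<open>(r - 1)\<^sup>2\<close> lines through
  no vertex form an \<open>(r - 2)\<close>-regular bipartite graph: a point on no side is joined to the three
  vertices by three different lines, and all its other lines miss the vertices. A maximal
  matching in a regular bipartite graph covers at least half of each side (lemma
  \<open>matching_of_size_exists\<close>), which is enough.

  Two lines still share at most one point, so there is no cycle shorter than 6. A 6-cycle survives:
  three non-collinear points, one on each side of the triangle, have degree \<open>r\<close> already and are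
  therefore not touched by the matching, and the lines joining them are not sides
  (lemma \<open>inscribed_triangle\<close>).

  The graph lives on the disjoint union of points and lines; any injection into the natural numbers
  then carries it over.
\<close>

section \<open>Graphs under injective relabelling\<close>

lemma is_cycle_map:
  assumes "inj_on f V" "set c \<subseteq> V" "is_cycle E c"
  shows "is_cycle ((`) f ` E) (map f c)"
proof -
  have "{map f c ! i, map f c ! (Suc i mod length (map f c))} \<in> (`) f ` E"
    if i: "i < length c" for i
  proof -
    have "Suc i mod length c < length c"
      using i by (intro mod_less_divisor) auto
    hence "{map f c ! i, map f c ! (Suc i mod length (map f c))} =
           f ` {c ! i, c ! (Suc i mod length c)}"
      using i by simp
    thus ?thesis
      using assms(3) i unfolding is_cycle_def by blast
  qed
  thus ?thesis
    using assms unfolding is_cycle_def by (auto simp: distinct_map intro: inj_on_subset)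
qed

lemma cycle_subset_vertices:
  assumes "simple_graph V E" "is_cycle E c"
  shows "set c \<subseteq> V"
proof
  fix v assume "v \<in> set c"
  then obtain i where "i < length c" "v = c ! i"
    by (auto simp: in_set_conv_nth)
  hence "{v, c ! (Suc i mod length c)} \<in> E"
    using assms(2) unfolding is_cycle_def by auto
  thus "v \<in> V"
    using assms(1) unfolding simple_graph_def by auto
qed

lemma image_image_edges_inverse:
  assumes "inj_on f V" "simple_graph V E"
  shows "(`) (inv_into V f) ` (`) f ` E = E"
proof -
  have "inv_into V f ` f ` e = e" if "e \<in> E" for e
    using assms that by (intro inv_into_image_cancel) (auto simp: simple_graph_def)
  thus ?thesis
    by (force simp: image_iff)
qed

lemma simple_graph_image:
  assumes "inj_on f V" "simple_graph V E"
  shows "simple_graph (f ` V) ((`) f ` E)"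
proof -
  have "card (f ` e) = card e" if "e \<in> E" for e
    using assms that by (intro card_image) (auto simp: simple_graph_def intro: inj_on_subset)
  thus ?thesis
    using assms(2) unfolding simple_graph_def by auto
qed

text \<open>
  Cycles of \<open>E\<close> map to cycles of the same length. Applied to \<open>f\<close> and to its inverse, this
  inequality gives the equality of girths.
\<close>

lemma girth_image_le:
  assumes "inj_on f V" "simple_graph V E"
  shows "girth ((`) f ` E) \<le> girth E"
  unfolding girth_def
proof (rule INF_greatest)
  fix c assume "c \<in> {c. is_cycle E c}"
  hence "is_cycle ((`) f ` E) (map f c)"
    using is_cycle_map[OF assms(1)] cycle_subset_vertices[OF assms(2)] by simp
  thus "(INF c\<in>{c. is_cycle ((`) f ` E) c}. enat (length c)) \<le> enat (length c)"
    by (intro INF_lower2[of "map f c"]) auto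
qed

lemma girth_image:
  assumes "inj_on f V" "simple_graph V E"
  shows "girth ((`) f ` E) = girth E"
proof (rule antisym)
  show "girth ((`) f ` E) \<le> girth E"
    by (rule girth_image_le[OF assms])
  have "girth ((`) (inv_into V f) ` (`) f ` E) \<le> girth ((`) f ` E)"
    by (intro girth_image_le[OF _ simple_graph_image[OF assms]] inj_on_inv_into subset_refl)
  thus "girth E \<le> girth ((`) f ` E)"
    unfolding image_image_edges_inverse[OF assms] .
qed

lemma degree_image:
  assumes "inj_on f V" "simple_graph V E" "v \<in> V"
  shows "degree ((`) f ` E) (f v) = degree E v"
proof -
  have edges: "E \<subseteq> Pow V"
    using assms(2) by (auto simp: simple_graph_def)
  have mem: "f v \<in> f ` e \<longleftrightarrow> v \<in> e" if "e \<in> E" for e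
    using assms(1,3) edges that by (intro inj_on_image_mem_iff) auto
  have "{e \<in> (`) f ` E. f v \<in> e} = (`) f ` {e \<in> E. v \<in> e}"
    using mem by auto
  moreover have "inj_on ((`) f) {e \<in> E. v \<in> e}"
    by (rule inj_on_subset[OF inj_on_image_Pow[OF assms(1)]]) (use edges in auto)
  ultimately show ?thesis
    unfolding degree_def by (simp add: card_image)
qed

lemma babi_graph_image:
  assumes "inj_on f V" "babi_graph r s g V E"
  shows "babi_graph r s g (f ` V) ((`) f ` E)"
proof -
  have simple: "simple_graph V E"
    using assms(2) by (simp add: babi_graph_def)
  note deg = degree_image[OF assms(1) simple]
  have "{v \<in> f ` V. degree ((`) f ` E) v = k} = f ` {v \<in> V. degree E v = k}" for k
    using deg by auto
  hence "card {v \<in> f ` V. degree ((`) f ` E) v = k} = card {v \<in> V. degree E v = k}" for k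
    using assms(1) by (auto intro!: card_image intro: inj_on_subset)
  moreover have "degree ((`) f ` E) ` f ` V = degree E ` V"
    using deg by (force simp: image_iff)
  ultimately show ?thesis
    using assms(2) simple_graph_image[OF assms(1) simple] girth_image[OF assms(1) simple]
    by (simp add: babi_graph_def)
qed

section \<open>The incidence graph of a relation\<close>

definition incidence_graph :: "('p \<times> 'l) set \<Rightarrow> ('p + 'l) set set" where
  "incidence_graph F = (\<lambda>(x, l). {Inl x, Inr l}) ` F"

lemma incidence_graph_iff [simp]:
  "{Inl x, Inr l} \<in> incidence_graph F \<longleftrightarrow> (x, l) \<in> F"
  "{Inr l, Inl x} \<in> incidence_graph F \<longleftrightarrow> (x, l) \<in> F"
  "{Inl x, Inl y} \<notin> incidence_graph F"
  "{Inr l, Inr m} \<notin> incidence_graph F"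
  by (auto simp: incidence_graph_def doubleton_eq_iff image_iff)

lemma simple_graph_incidence_graph:
  assumes "finite X" "finite Y" "F \<subseteq> X \<times> Y"
  shows "simple_graph (X <+> Y) (incidence_graph F)"
  using assms unfolding simple_graph_def incidence_graph_def by auto

lemma degree_incidence_graph_Inl:
  "degree (incidence_graph F) (Inl x) = card {l. (x, l) \<in> F}"
proof -
  have "{e \<in> incidence_graph F. Inl x \<in> e} = (\<lambda>l. {Inl x, Inr l}) ` {l. (x, l) \<in> F}"
    by (auto simp: incidence_graph_def)
  moreover have "inj_on (\<lambda>l. {Inl x, Inr l}) {l. (x, l) \<in> F}"
    by (auto simp: inj_on_def doubleton_eq_iff)
  ultimately show ?thesis
    by (simp add: degree_def card_image)
qed

lemma degree_incidence_graph_Inr: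
  "degree (incidence_graph F) (Inr l) = card {x. (x, l) \<in> F}"
proof -
  have "{e \<in> incidence_graph F. Inr l \<in> e} = (\<lambda>x. {Inl x, Inr l}) ` {x. (x, l) \<in> F}"
    by (auto simp: incidence_graph_def)
  moreover have "inj_on (\<lambda>x. {Inl x, Inr l}) {x. (x, l) \<in> F}"
    by (auto simp: inj_on_def doubleton_eq_iff)
  ultimately show ?thesis
    by (simp add: degree_def card_image)
qed

text \<open>
  A cycle alternates between points and lines, so its length is even; a cycle of length 4 would
  consist of two points on two common lines.
\<close>

lemma incidence_graph_no_short_cycle:
  assumes linear: "\<And>x y l m. \<lbrakk>(x, l) \<in> F; (x, m) \<in> F; (y, l) \<in> F; (y, m) \<in> F\<rbrakk> \<Longrightarrow> x = y \<or> l = m"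
    and cycle: "is_cycle (incidence_graph F) c"
  shows "length c \<ge> 6"
proof (rule ccontr)
  assume "\<not> length c \<ge> 6"
  hence len: "length c \<in> {3, 4, 5}"
    using cycle by (auto simp: is_cycle_def)
  have adj: "{c ! i, c ! j} \<in> incidence_graph F" if "i < length c" "j = Suc i mod length c" for i j
    using cycle that by (simp add: is_cycle_def)
  have alt: "isl (c ! i) \<longleftrightarrow> \<not> isl (c ! j)" if "i < length c" "j = Suc i mod length c" for i j
    using adj[OF that] by (cases "c ! i"; cases "c ! j") auto
  consider "length c = 3" | "length c = 4" | "length c = 5"
    using len by auto
  thus False
  proof cases
    case 1
    thus False using alt[of 0 1] alt[of 1 2] alt[of 2 0] by simp
  next
    case 3
    thus False using alt[of 0 1] alt[of 1 2] alt[of 2 3] alt[of 3 4] alt[of 4 0] by simp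
  next
    case 2
    then obtain u v w z where c: "c = [u, v, w, z]"
      by (auto simp: numeral_eq_Suc length_Suc_conv)
    have "{u, v} \<in> incidence_graph F" "{v, w} \<in> incidence_graph F"
      "{w, z} \<in> incidence_graph F" "{z, u} \<in> incidence_graph F"
      using adj[of 0 1] adj[of 1 2] adj[of 2 3] adj[of 3 0] c by simp_all
    moreover have "u \<noteq> w" "v \<noteq> z"
      using cycle c by (auto simp: is_cycle_def)
    ultimately show False
      by (cases u; cases v; cases w; cases z) (auto dest: linear)
  qed
qed

lemma girth_incidence_graph:
  assumes linear: "\<And>x y l m. \<lbrakk>(x, l) \<in> F; (x, m) \<in> F; (y, l) \<in> F; (y, m) \<in> F\<rbrakk> \<Longrightarrow> x = y \<or> l = m"
    and points: "distinct [x, y, z]" and lines: "distinct [l, m, n]"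
    and hexagon: "{(x, l), (y, l), (y, m), (z, m), (z, n), (x, n)} \<subseteq> F"
  shows "girth (incidence_graph F) = 6"
proof (rule antisym)
  let ?c = "[Inl x, Inr l, Inl y, Inr m, Inl z, Inr n]"
  have "is_cycle (incidence_graph F) ?c"
    unfolding is_cycle_def
  proof (intro conjI allI impI)
    fix i assume "i < length ?c"
    hence "i \<in> {0, 1, 2, 3, 4, 5}" by auto
    moreover have len: "length ?c = 6" by simp
    ultimately show "{?c ! i, ?c ! (Suc i mod length ?c)} \<in> incidence_graph F"
      using hexagon unfolding len by auto
  qed (use points lines in auto)
  hence "girth (incidence_graph F) \<le> enat (length ?c)"
    unfolding girth_def by (intro INF_lower) simp
  also have "length ?c = 6"
    by simp
  finally show "girth (incidence_graph F) \<le> 6"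
    by (simp add: numeral_eq_enat)
  show "6 \<le> girth (incidence_graph F)"
    unfolding girth_def
    using incidence_graph_no_short_cycle[OF linear]
    by (intro INF_greatest) (auto simp: numeral_eq_enat)
qed

section \<open>Large matchings in regular bipartite graphs\<close>

text \<open>
  Greedy extension works up to half of \<open>X\<close>. If a matching \<open>M\<close> of size \<open>k\<close> cannot be extended, all
  edges from the \<open>card X - k\<close> uncovered elements of \<open>X\<close> end in the \<open>k\<close> covered elements of \<open>Y\<close>.
  Counting these edges gives \<open>(card X - k) * d \<le> k * d\<close>, hence \<open>card X \<le> 2 * k\<close>.
\<close>

lemma matching_of_size_exists:
  assumes fin: "finite X" "finite Y" and sub: "F \<subseteq> X \<times> Y"
    and degX: "\<And>x. x \<in> X \<Longrightarrow> card {l. (x, l) \<in> F} = d"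
    and degY: "\<And>l. l \<in> Y \<Longrightarrow> card {x. (x, l) \<in> F} \<le> d"
    and "d > 0" and "2 * k \<le> card X"
  shows "\<exists>M\<subseteq>F. card M = k \<and> inj_on fst M \<and> inj_on snd M"
  using assms(7)
proof (induction k)
  case 0
  show ?case by (intro exI[of _ "{}"]) auto
next
  case (Suc k)
  then obtain M where M: "M \<subseteq> F" "card M = k" "inj_on fst M" "inj_on snd M"
    by auto
  have finF: "finite F"
    using fin sub by (meson finite_SigmaI finite_subset)
  have finM: "finite M"
    using M(1) finF by (rule finite_subset)
  have "\<exists>x l. (x, l) \<in> F \<and> x \<notin> fst ` M \<and> l \<notin> snd ` M"
  proof (rule ccontr)
    assume "\<not> ?thesis"
    hence covered: "l \<in> snd ` M" if "(x, l) \<in> F" "x \<notin> fst ` M" for x l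
      using that by blast
    let ?U = "X - fst ` M"
    have "card ?U = card X - k"
      using M sub fin(1) finM by (subst card_Diff_subset) (auto simp: card_image)
    hence "(card X - k) * d = card (SIGMA x:?U. {l. (x, l) \<in> F})"
      using fin sub degX by (subst card_SigmaI) (auto intro: finite_subset[of _ Y])
    also have "\<dots> \<le> card (SIGMA l:snd ` M. {x. (x, l) \<in> F})"
      using finM fin sub covered
      by (intro card_inj_on_le[of prod.swap] finite_SigmaI)
         (auto intro: finite_subset[of _ X] simp: inj_on_def)
    also have "card (SIGMA l:snd ` M. {x. (x, l) \<in> F}) \<le> k * d"
    proof -
      have "card (SIGMA l:snd ` M. {x. (x, l) \<in> F}) = (\<Sum>l\<in>snd ` M. card {x. (x, l) \<in> F})"
        using finM fin sub by (intro card_SigmaI) (auto intro: finite_subset[of _ X])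
      also have "\<dots> \<le> card (snd ` M) * d"
      proof -
        have "card {x. (x, l) \<in> F} \<le> d" if "l \<in> snd ` M" for l
          using that M(1) sub by (intro degY) auto
        thus ?thesis
          using sum_bounded_above[of "snd ` M" "\<lambda>l. card {x. (x, l) \<in> F}" d] by simp
      qed
      finally show ?thesis
        using M by (simp add: card_image)
    qed
    finally have "(card X - k) * d \<le> k * d" .
    thus False
      using \<open>d > 0\<close> Suc.prems by simp
  qed
  then obtain x l where "(x, l) \<in> F" "x \<notin> fst ` M" "l \<notin> snd ` M"
    by blast
  moreover from this have "(x, l) \<notin> M"
    by force
  ultimately show ?case
    using M finM by (intro exI[of _ "insert (x, l) M"]) (auto simp: inj_on_insert)
qed

section \<open>A triangle in a projective plane\<close>

text \<open>
  The side named by a capital letter is opposite to the vertex named by the small letter. The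
  assumptions are self-dual, so each statement about points below also holds for lines.
\<close>

locale plane_triangle =
  fixes r :: nat
    and P :: "'p set" and L :: "'l set" and I :: "'p \<Rightarrow> 'l \<Rightarrow> bool"
    and a b c :: 'p and A B C :: 'l
  assumes plane: "projective_plane r P L I"
    and vertices: "a \<in> P" "b \<in> P" "c \<in> P"
    and sides: "A \<in> L" "B \<in> L" "C \<in> L"
    and on: "I b A" "I c A" "I a B" "I c B" "I a C" "I b C"
    and off: "\<not> I a A" "\<not> I b B" "\<not> I c C"
begin

lemma dual: "plane_triangle r L P (\<lambda>l x. I x l) A B C a b c"
  using plane vertices sides on off
  unfolding plane_triangle_def projective_plane_def by simp

lemma distinct_vertices: "a \<noteq> b" "b \<noteq> c" "a \<noteq> c"
  using on off by auto

lemma distinct_sides: "A \<noteq> B" "B \<noteq> C" "A \<noteq> C"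
  using on off by auto

lemma finite_points: "finite P" and finite_lines: "finite L"
  and card_points: "card P = r\<^sup>2 + r + 1"
  using plane unfolding projective_plane_def by auto

lemma line_exists: "\<lbrakk>x \<in> P; y \<in> P; x \<noteq> y\<rbrakk> \<Longrightarrow> \<exists>l\<in>L. I x l \<and> I y l"
  using plane unfolding projective_plane_def by blast

lemma line_unique:
  "\<lbrakk>x \<in> P; y \<in> P; x \<noteq> y; l \<in> L; m \<in> L; I x l; I y l; I x m; I y m\<rbrakk> \<Longrightarrow> l = m"
  using plane unfolding projective_plane_def by blast

lemma card_on_line: "l \<in> L \<Longrightarrow> card {x \<in> P. I x l} = r + 1"
  and card_through_point: "x \<in> P \<Longrightarrow> card {l \<in> L. I x l} = r + 1"
  using plane unfolding projective_plane_def by auto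

definition on_one_side :: "'p set" where
  "on_one_side = {x \<in> P - {a, b, c}. I x A \<or> I x B \<or> I x C}"

definition on_no_side :: "'p set" where
  "on_no_side = {x \<in> P. \<not> I x A \<and> \<not> I x B \<and> \<not> I x C}"

lemma on_no_side_iff:
  "on_no_side = P - {a, b, c} - on_one_side"
  using on by (auto simp: on_one_side_def on_no_side_def)

lemma meet_of_sides:
  assumes "x \<in> P"
  shows "I x A \<Longrightarrow> I x B \<Longrightarrow> x = c" "I x B \<Longrightarrow> I x C \<Longrightarrow> x = a" "I x A \<Longrightarrow> I x C \<Longrightarrow> x = b"
  using line_unique[OF assms vertices(3) _ sides(1,2)] line_unique[OF assms vertices(1) _ sides(2,3)]
    line_unique[OF assms vertices(2) _ sides(1,3)] on distinct_sides by auto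

lemma card_side:
  assumes "(Z = A \<and> u = b \<and> v = c) \<or> (Z = B \<and> u = a \<and> v = c) \<or> (Z = C \<and> u = a \<and> v = b)"
  shows "card ({x \<in> P. I x Z} - {u, v}) = r - 1"
proof -
  have "Z \<in> L" "u \<noteq> v" "{u, v} \<subseteq> {x \<in> P. I x Z}"
    using assms sides on vertices distinct_vertices by auto
  thus ?thesis
    using card_on_line[of Z] by (subst card_Diff_subset) auto
qed

lemma card_on_one_side: "card on_one_side = 3 * (r - 1)"
proof -
  let ?A = "{x \<in> P. I x A} - {b, c}" and ?B = "{x \<in> P. I x B} - {a, c}"
    and ?C = "{x \<in> P. I x C} - {a, b}"
  have "on_one_side = ?A \<union> ?B \<union> ?C"
    unfolding on_one_side_def using off by auto
  moreover have "?A \<inter> ?B = {}" "(?A \<union> ?B) \<inter> ?C = {}"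
    using meet_of_sides by auto
  hence "card (?A \<union> ?B \<union> ?C) = card ?A + card ?B + card ?C"
    using finite_points by (simp add: card_Un_disjoint)
  ultimately show ?thesis
    using card_side by simp
qed

lemma card_kept_points: "card (P - {a, b, c}) = r\<^sup>2 + r - 2"
proof -
  have "card {a, b, c} = 3"
    using distinct_vertices by simp
  hence "card (P - {a, b, c}) = card P - 3"
    using card_Diff_subset[of "{a, b, c}" P] vertices by simp
  thus ?thesis
    by (simp add: card_points)
qed

lemma card_on_no_side: "card on_no_side = r\<^sup>2 + r - 2 - 3 * (r - 1)"
proof -
  have "on_one_side \<subseteq> P - {a, b, c}"
    by (auto simp: on_one_side_def)
  thus ?thesis
    unfolding on_no_side_iff card_kept_points[symmetric] card_on_one_side[symmetric]
    using finite_points by (intro card_Diff_subset) (auto intro: finite_subset)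
qed

lemma card_kept_lines_through:
  assumes "x \<in> P - {a, b, c}"
  shows "card {l \<in> L - {A, B, C}. I x l} = (if x \<in> on_one_side then r else r + 1)"
proof (cases "x \<in> on_one_side")
  case True
  hence "\<exists>Z\<in>{A, B, C}. I x Z"
    by (auto simp: on_one_side_def)
  then obtain Z where Z: "Z \<in> {A, B, C}" "I x Z"
    by blast
  have "{l \<in> L - {A, B, C}. I x l} = {l \<in> L. I x l} - {Z}"
    using Z meet_of_sides[of x] assms by auto
  moreover have "Z \<in> {l \<in> L. I x l}"
    using Z sides by auto
  ultimately show ?thesis
    using True card_through_point[of x] assms by simp
next
  case False
  hence "{l \<in> L - {A, B, C}. I x l} = {l \<in> L. I x l}"
    using assms by (auto simp: on_one_side_def)
  thus ?thesis
    using False card_through_point[of x] assms by simp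
qed

text \<open>
  The lines joining \<open>x\<close> to the three vertices are distinct: if two of them coincided, the common
  line would be a side through \<open>x\<close>.
\<close>

lemma card_lines_through_missing_vertices:
  assumes "x \<in> on_no_side"
  shows "card {l \<in> L. I x l \<and> \<not> I a l \<and> \<not> I b l \<and> \<not> I c l} = r - 2"
proof -
  have x: "x \<in> P" "x \<noteq> a" "x \<noteq> b" "x \<noteq> c" "\<not> I x A" "\<not> I x B" "\<not> I x C"
    using assms on by (auto simp: on_no_side_def)
  obtain la where la: "la \<in> L" "I x la" "I a la"
    using line_exists[of x a] x vertices by blast
  obtain lb where lb: "lb \<in> L" "I x lb" "I b lb"
    using line_exists[of x b] x vertices by blast
  obtain lc where lc: "lc \<in> L" "I x lc" "I c lc"
    using line_exists[of x c] x vertices by blast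
  have "la \<noteq> lb" "lb \<noteq> lc" "la \<noteq> lc"
    using line_unique[of a b la C] line_unique[of b c lb A] line_unique[of a c la B]
      la lb lc x vertices sides on distinct_vertices by auto
  moreover have "{l \<in> L. I x l \<and> \<not> I a l \<and> \<not> I b l \<and> \<not> I c l} = {l \<in> L. I x l} - {la, lb, lc}"
    using line_unique[OF x(1)] vertices x(2-4) la lb lc by blast
  ultimately show ?thesis
    using card_through_point[OF x(1)] la lb lc by (simp add: card_Diff_subset)
qed

text \<open>
  The degree of a point in the final graph. Matched points lie on no side, so that no point loses
  an edge both to a deleted side and to the matching.
\<close>

lemma card_kept_lines_through_minus_matching:
  assumes x: "x \<in> P - {a, b, c}"
    and M: "M \<subseteq> on_no_side \<times> (L - {A, B, C})" "\<And>x l. (x, l) \<in> M \<Longrightarrow> I x l" "inj_on fst M"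
  shows "card {l \<in> L - {A, B, C}. I x l \<and> (x, l) \<notin> M} =
         (if x \<in> on_one_side \<union> fst ` M then r else r + 1)"
proof (cases "x \<in> fst ` M")
  case True
  then obtain l where l: "(x, l) \<in> M"
    by auto
  have "(x, m) \<in> M \<longleftrightarrow> m = l" for m
    using inj_onD[OF M(3) _ _ l, of "(x, m)"] l by auto
  hence "{l \<in> L - {A, B, C}. I x l \<and> (x, l) \<notin> M} = {l \<in> L - {A, B, C}. I x l} - {l}"
    by auto
  moreover have "l \<in> {l \<in> L - {A, B, C}. I x l}" "x \<notin> on_one_side"
    using M l on_no_side_iff by auto
  ultimately show ?thesis
    using card_kept_lines_through[OF x] True by simp
next
  case False
  hence "{l \<in> L - {A, B, C}. I x l \<and> (x, l) \<notin> M} = {l \<in> L - {A, B, C}. I x l}"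
    by force
  thus ?thesis
    using card_kept_lines_through[OF x] False by simp
qed

text \<open>
  Source of the 6-cycle. Pick any \<open>x\<close> and \<open>y\<close> on two sides, neither a vertex. On the third side there are
  \<open>r - 1 \<ge> 2\<close> points other than the vertices, and at most one of them lies on the line \<open>x y\<close>.
\<close>

lemma inscribed_triangle:
  assumes "r > 2"
  obtains x y z l m n where
    "x \<in> on_one_side" "y \<in> on_one_side" "z \<in> on_one_side" "distinct [x, y, z]"
    "l \<in> L - {A, B, C}" "m \<in> L - {A, B, C}" "n \<in> L - {A, B, C}" "distinct [l, m, n]"
    "I x l" "I y l" "I y m" "I z m" "I z n" "I x n"
proof -
  have cards: "card ({x \<in> P. I x A} - {b, c}) > 0" "card ({x \<in> P. I x B} - {a, c}) > 1"
    "card ({x \<in> P. I x C} - {a, b}) > 0"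
    using card_side assms by simp_all
  obtain x where x: "x \<in> {x \<in> P. I x C} - {a, b}"
    using card_gt_0_iff[THEN iffD1, OF cards(3)] by blast
  obtain y where y: "y \<in> {x \<in> P. I x A} - {b, c}"
    using card_gt_0_iff[THEN iffD1, OF cards(1)] by blast
  have out: "x \<noteq> c" "y \<noteq> a"
    using x y off by auto
  have "x \<noteq> y"
    using x y meet_of_sides(3)[of x] by auto
  then obtain l where l: "l \<in> L" "I x l" "I y l"
    using line_exists[of x y] x y by blast
  have lB: "l \<noteq> A" "l \<noteq> B" "l \<noteq> C"
    using l x y meet_of_sides[of x] meet_of_sides[of y] out by auto
  have "\<exists>z \<in> {x \<in> P. I x B} - {a, c}. \<not> I z l"
  proof (rule ccontr)
    assume neg: "\<not> ?thesis"
    have "u = v" if "u \<in> {x \<in> P. I x B} - {a, c}" "v \<in> {x \<in> P. I x B} - {a, c}" for u v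
      using neg that line_unique[of u v l B] l lB sides by blast
    moreover have "finite ({x \<in> P. I x B} - {a, c})"
      using finite_points by simp
    ultimately have "card ({x \<in> P. I x B} - {a, c}) \<le> Suc 0"
      using card_le_Suc0_iff_eq[of "{x \<in> P. I x B} - {a, c}"] by blast
    thus False
      using cards(2) by simp
  qed
  then obtain z where z: "z \<in> {x \<in> P. I x B} - {a, c}" "\<not> I z l"
    by blast
  have "z \<noteq> b"
    using z off by auto
  have ne: "z \<noteq> x" "z \<noteq> y"
    using z l by auto
  obtain m where m: "m \<in> L" "I y m" "I z m"
    using line_exists[of y z] y z ne by blast
  obtain n where n: "n \<in> L" "I z n" "I x n"
    using line_exists[of z x] x z ne by blast
  have "m \<notin> {A, B, C}" "n \<notin> {A, B, C}"
    using m n x y z \<open>z \<noteq> b\<close> out meet_of_sides[of x] meet_of_sides[of y] meet_of_sides[of z] by auto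
  moreover have "m \<noteq> n"
    using line_unique[of x y l m] x y l m n z \<open>x \<noteq> y\<close> by auto
  ultimately show ?thesis
    using x y z l m n lB ne out \<open>x \<noteq> y\<close> \<open>z \<noteq> b\<close>
    by (intro that[of x y z l m n]) (auto simp: on_one_side_def)
qed

end

lemma triangle_exists:
  assumes "projective_plane r P L I" and "r > 1"
  shows "\<exists>a b c A B C. plane_triangle r P L I a b c A B C"
proof -
  have fin: "finite P" and cardP: "card P = r\<^sup>2 + r + 1"
    and join: "\<And>x y. \<lbrakk>x \<in> P; y \<in> P; x \<noteq> y\<rbrakk> \<Longrightarrow> \<exists>!l. l \<in> L \<and> I x l \<and> I y l"
    and on_line: "\<And>l. l \<in> L \<Longrightarrow> card {x \<in> P. I x l} = r + 1"
    using assms(1) unfolding projective_plane_def by blast+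
  have "\<not> card P \<le> Suc 0"
    using cardP assms(2) by simp
  then obtain a b where ab: "a \<in> P" "b \<in> P" "a \<noteq> b"
    using fin by (auto simp: card_le_Suc0_iff_eq)
  then obtain C where C: "C \<in> L" "I a C" "I b C"
    using join by blast
  have "card {x \<in> P. I x C} < card P"
    using on_line[OF C(1)] cardP assms(2) by (simp add: power2_eq_square)
  hence "\<exists>c\<in>P. \<not> I c C"
    using card_mono[of "{x \<in> P. I x C}" P] fin
    by (metis (mono_tags, lifting) linorder_not_le mem_Collect_eq rev_finite_subset subsetI)
  then obtain c where c: "c \<in> P" "\<not> I c C"
    by blast
  obtain A where A: "A \<in> L" "I b A" "I c A"
    using join[of b c] ab c C by blast
  obtain B where B: "B \<in> L" "I a B" "I c B"
    using join[of a c] ab c C by blast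
  have "\<not> I a A" "\<not> I b B"
    using join[OF ab] A B C c by blast+
  thus ?thesis
    using assms(1) ab c A B C unfolding plane_triangle_def by blast
qed

section \<open>The graph\<close>

context plane_triangle
begin

lemma babi_graph_exists:
  assumes r: "r > 3"
  shows "\<exists>(V :: ('p + 'l) set) E. babi_graph r (r + 1) 6 V E \<and> card V = 2 * (r\<^sup>2 + r - 2)"
proof -
  interpret dual: plane_triangle r L P "\<lambda>l x. I x l" A B C a b c
    by (rule dual)
  define k where "k = (r - 1) * (r - 4) div 2"
  \<comment> \<open>Writing \<open>r\<close> as \<open>t + 4\<close> avoids truncated subtraction in the counts below.\<close>
  obtain t where t: "r = t + 4"
    using r that[of "r - 4"] by simp
  have "even ((t + 3) * t)"
    by auto
  hence k: "2 * k = (t + 3) * t"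
    by (simp add: k_def t)
  have size: "r\<^sup>2 + r - 2 = (t + 3) * (t + 6)"
    by (simp add: t power2_eq_square algebra_simps)
  have card_off: "card on_no_side = (t + 3) * (t + 3)"
    unfolding card_on_no_side size by (simp add: t algebra_simps)
  let ?N = "{(x, l). x \<in> on_no_side \<and> l \<in> dual.on_no_side \<and> I x l}"
  have "\<exists>M\<subseteq>?N. card M = k \<and> inj_on fst M \<and> inj_on snd M"
  proof (rule matching_of_size_exists[where d = "r - 2"])
    show "finite on_no_side" "finite dual.on_no_side"
      using finite_points finite_lines by (auto simp: on_no_side_def dual.on_no_side_def)
    show "card {l. (x, l) \<in> ?N} = r - 2" if "x \<in> on_no_side" for x
      using card_lines_through_missing_vertices[OF that] that
      by (simp add: dual.on_no_side_def conj_ac)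
    show "card {x. (x, l) \<in> ?N} \<le> r - 2" if "l \<in> dual.on_no_side" for l
      using dual.card_lines_through_missing_vertices[OF that] that
      by (simp add: on_no_side_def conj_ac)
    show "2 * k \<le> card on_no_side"
      unfolding k card_off by simp
  qed (use r in auto)
  then obtain M where M: "M \<subseteq> ?N" "card M = k" "inj_on fst M" "inj_on snd M"
    by blast
  define X where "X = P - {a, b, c}"
  define Y where "Y = L - {A, B, C}"
  define F where "F = {(x, l). x \<in> X \<and> l \<in> Y \<and> I x l} - M"
  define V where "V = X <+> Y"
  \<comment> \<open>The future vertices of degree \<open>r\<close>.\<close>
  define low where "low = (on_one_side \<union> fst ` M) <+> (dual.on_one_side \<union> snd ` M)"
  have fin: "finite X" "finite Y"
    using finite_points finite_lines by (auto simp: X_def Y_def)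
  have simple: "simple_graph V (incidence_graph F)"
    unfolding V_def using fin by (intro simple_graph_incidence_graph) (auto simp: F_def)
  have card_XY: "card X = (t + 3) * (t + 6)" "card Y = (t + 3) * (t + 6)"
    unfolding X_def Y_def card_kept_points dual.card_kept_points size by simp_all

  have deg_point: "degree (incidence_graph F) (Inl x) = (if Inl x \<in> low then r else r + 1)"
    if x: "x \<in> X" for x
  proof -
    have "{l. (x, l) \<in> F} = {l \<in> L - {A, B, C}. I x l \<and> (x, l) \<notin> M}"
      using x by (auto simp: F_def Y_def)
    moreover have "card {l \<in> L - {A, B, C}. I x l \<and> (x, l) \<notin> M} =
                   (if x \<in> on_one_side \<union> fst ` M then r else r + 1)"
      by (rule card_kept_lines_through_minus_matching)
         (use x M dual.on_no_side_iff in \<open>auto simp: X_def\<close>)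
    ultimately show ?thesis
      by (auto simp: degree_incidence_graph_Inl low_def)
  qed
  have deg_line: "degree (incidence_graph F) (Inr l) = (if Inr l \<in> low then r else r + 1)"
    if l: "l \<in> Y" for l
  proof -
    have "{x. (x, l) \<in> F} = {x \<in> P - {a, b, c}. I x l \<and> (l, x) \<notin> M\<inverse>}"
      using l by (auto simp: F_def X_def)
    moreover have "inj_on fst (M\<inverse>)"
    proof (rule inj_onI)
      fix p q assume "p \<in> M\<inverse>" "q \<in> M\<inverse>" "fst p = fst q"
      thus "p = q"
        using inj_onD[OF M(4), of "prod.swap p" "prod.swap q"] by (cases p; cases q) auto
    qed
    hence "card {x \<in> P - {a, b, c}. I x l \<and> (l, x) \<notin> M\<inverse>} =
                   (if l \<in> dual.on_one_side \<union> fst ` (M\<inverse>) then r else r + 1)"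
      by (intro dual.card_kept_lines_through_minus_matching)
         (use l M(1) on_no_side_iff in \<open>auto simp: Y_def\<close>)
    moreover have "fst ` (M\<inverse>) = snd ` M"
      by force
    ultimately show ?thesis
      by (auto simp: degree_incidence_graph_Inr low_def)
  qed
  have deg: "degree (incidence_graph F) v = (if v \<in> low then r else r + 1)" if "v \<in> V" for v
    using that deg_point deg_line by (auto simp: V_def)

  have deg_iff: "degree (incidence_graph F) v = r \<longleftrightarrow> v \<in> low"
    "degree (incidence_graph F) v = r + 1 \<longleftrightarrow> v \<notin> low" if "v \<in> V" for v
    using deg[OF that] by simp_all

  have card_V: "card V = 2 * (r\<^sup>2 + r - 2)"
    using fin card_XY by (simp add: V_def card_Plus size)
  have low_V: "low \<subseteq> V"
    using M(1) on_no_side_iff dual.on_no_side_iff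
    by (auto simp: low_def V_def X_def Y_def on_one_side_def dual.on_one_side_def)
  have "card low = (t + 3) * (t + 6)"
  proof -
    have "finite M"
      by (rule finite_subset[of _ "X \<times> Y"])
         (use fin M(1) on_no_side_iff dual.on_no_side_iff in \<open>auto simp: X_def Y_def\<close>)
    moreover have "on_one_side \<inter> fst ` M = {}" "dual.on_one_side \<inter> snd ` M = {}"
      using M(1) on_no_side_iff dual.on_no_side_iff by auto
    moreover have "finite on_one_side" "finite dual.on_one_side"
      using finite_points finite_lines by (auto simp: on_one_side_def dual.on_one_side_def)
    ultimately have "card low = 6 * (r - 1) + 2 * k"
      using M by (simp add: low_def card_Plus card_Un_disjoint card_image card_on_one_side
          dual.card_on_one_side)
    thus ?thesis
      unfolding k by (simp add: t algebra_simps)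
  qed
  moreover have "{v \<in> V. degree (incidence_graph F) v = r} = low"
    using deg_iff(1) low_V by blast
  moreover have "{v \<in> V. degree (incidence_graph F) v = r + 1} = V - low"
    using deg_iff(2) by blast
  moreover have "card (V - low) = card V - card low"
    using low_V fin by (intro card_Diff_subset) (auto simp: V_def intro: finite_subset)
  ultimately have cards: "card {v \<in> V. degree (incidence_graph F) v = r} = (t + 3) * (t + 6)"
    "card {v \<in> V. degree (incidence_graph F) v = r + 1} = (t + 3) * (t + 6)"
    using card_V size by simp_all
  have "{v \<in> V. degree (incidence_graph F) v = r} \<noteq> {}"
    "{v \<in> V. degree (incidence_graph F) v = r + 1} \<noteq> {}"
    using cards by (metis card.empty mult_is_0 add_is_0 zero_neq_numeral)+
  hence "r \<in> degree (incidence_graph F) ` V" "r + 1 \<in> degree (incidence_graph F) ` V"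
    by force+
  moreover have "degree (incidence_graph F) ` V \<subseteq> {r, r + 1}"
    using deg by auto
  ultimately have degrees: "degree (incidence_graph F) ` V = {r, r + 1}"
    by (intro subset_antisym) simp_all

  have r2: "r > 2"
    using r by simp
  obtain x y z l m n where hexagon:
    "x \<in> on_one_side" "y \<in> on_one_side" "z \<in> on_one_side" "distinct [x, y, z]"
    "l \<in> L - {A, B, C}" "m \<in> L - {A, B, C}" "n \<in> L - {A, B, C}" "distinct [l, m, n]"
    "I x l" "I y l" "I y m" "I z m" "I z n" "I x n"
    using inscribed_triangle[OF r2] by blast
  have side_F: "(u, h) \<in> F" if "u \<in> on_one_side" "h \<in> L - {A, B, C}" "I u h" for u h
    using that M(1) on_no_side_iff by (auto simp: F_def X_def Y_def on_one_side_def)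
  have "girth (incidence_graph F) = 6"
  proof (rule girth_incidence_graph)
    show "u = v \<or> g = h" if "(u, g) \<in> F" "(u, h) \<in> F" "(v, g) \<in> F" "(v, h) \<in> F" for u v g h
      using that line_unique[of u v g h] by (auto simp: F_def X_def Y_def)
    show "distinct [x, y, z]" "distinct [l, m, n]"
      by fact+
    show "{(x, l), (y, l), (y, m), (z, m), (z, n), (x, n)} \<subseteq> F"
      using hexagon side_F by auto
  qed
  hence "babi_graph r (r + 1) 6 V (incidence_graph F)"
    using simple degrees cards by (simp add: babi_graph_def numeral_eq_enat)
  thus ?thesis
    using card_V by blast
qed

end

theorem theorem6p5:
  fixes r :: nat
    and P :: "'p set" and L :: "'l set" and I :: "'p \<Rightarrow> 'l \<Rightarrow> bool"
  assumes "r > 3"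
    and "projective_plane r P L I"
  shows "\<exists>(V :: nat set) (E :: nat set set).
           babi_graph r (r + 1) 6 V E \<and> card V = 2 * (r\<^sup>2 + r - 2)"
proof -
  have "r > 1"
    using assms(1) by simp
  then obtain a b c A B C where "plane_triangle r P L I a b c A B C"
    using triangle_exists[OF assms(2)] by blast
  then interpret plane_triangle r P L I a b c A B C .
  obtain V :: "('p + 'l) set" and E where V: "babi_graph r (r + 1) 6 V E" "card V = 2 * (r\<^sup>2 + r - 2)"
    using babi_graph_exists assms(1) by blast
  hence "finite V"
    by (simp add: babi_graph_def simple_graph_def)
  from finite_imp_inj_to_nat_seg[OF this]
  obtain f :: "'p + 'l \<Rightarrow> nat" where f: "inj_on f V"
    by blast
  have "card (f ` V) = 2 * (r\<^sup>2 + r - 2)"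
    using V(2) card_image[OF f] by simp
  thus ?thesis
    using babi_graph_image[OF f V(1)] by blast
qed

end
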